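(* Let $X$ be an F-$\mathbb{BC}$ module with hyperbolic norm $\|\cdot\|_{\mathbb{D}}$, and let $p_{\mathbb{D}}$ be a hyperbolic semi-norm on $X$. Then $p_{\mathbb{D}}$ is continuous on $X$ if and only if there exists $\alpha\in\mathbb{D}^+$ such that $p_{\mathbb{D}}(x)\le\alpha\|x\|_{\mathbb{D}}$ for all $x\in X$.
   Context: Bicomplex and hyperbolic numbers. $\mathbb{BC}=\{z_1+z_2 j : z_1,z_2\in\mathbb{C}(i)\}$ with $i^2=j^2=-1$, $ij=ji=k$ (so $k^2=1$); it is a commutative ring. $\mathbb{D}=\{\beta_1+k\beta_2:\beta_1,\beta_2\in\mathbb{R}\}\subset\mathbb{BC}$ is the ring of hyperbolic numbers. With $e_1=\frac{1+k}{2}$, $e_2=\frac{1-k}{2}$ one has $e_1^2=e_1$, $e_2^2=e_2$, $e_1+e_2=1$, $e_1e_2=0$, and each $Z\in\mathbb{BC}$ is uniquely $Z=e_1z_1+e_2z_2$ with $z_1,z_2\in\mathbb{C}(i)$; $Z\in\mathbb{D}$ iff $z_1,z_2$ are real. Put $|Z|_k=e_1|z_1|+e_2|z_2|$. Let $\mathbb{D}^+=\{e_1\alpha_1+e_2\alpha_2:\alpha_1,\alpha_2\ge 0\}$. The partial order on $\mathbb{D}$ is $\alpha\le\beta$ iff $\beta-\alpha\in\mathbb{D}^+$. Convergence in $\mathbb{D}$ is componentwise with respect to $e_1,e_2$. Norms and semi-norms. A hyperbolic semi-norm on a $\mathbb{BC}$-module $X$ is a map $p_{\mathbb{D}}:X\to\mathbb{D}^+$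 with $p_{\mathbb{D}}(\mu x)=|\mu|_k\,p_{\mathbb{D}}(x)$ and $p_{\mathbb{D}}(x+y)\le p_{\mathbb{D}}(x)+p_{\mathbb{D}}(y)$ for all $x,y\in X$, $\mu\in\mathbb{BC}$. A hyperbolic norm $\|\cdot\|_{\mathbb{D}}$ is a hyperbolic semi-norm that vanishes only at $x=0$. $x_n\to x$ means $\|x_n-x\|_{\mathbb{D}}\to 0$ in $\mathbb{D}$. An F-$\mathbb{BC}$ module is a $\mathbb{BC}$-module with a hyperbolic norm for which every Cauchy sequence converges. Continuity of $p_{\mathbb{D}}$ on $X$ means: $x_n\to x$ in $X$ implies $p_{\mathbb{D}}(x_n)\to p_{\mathbb{D}}(x)$ in $\mathbb{D}$. *)

theory Defs
  imports Complex_Main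
begin

section \<open>Bicomplex numbers\<close>

text \<open>\<open>Bicomplex z\<^sub>1 z\<^sub>2\<close> stands for \<open>z\<^sub>1 + z\<^sub>2 j\<close>; the multiplication is determined by
  \<open>j\<^sup>2 = -1\<close> and by \<open>j\<close> commuting with complex numbers.\<close>

datatype bicomplex = Bicomplex (bc_fst: complex) (bc_snd: complex)

lemma bicomplex_eq_iff: "Z = W \<longleftrightarrow> bc_fst Z = bc_fst W \<and> bc_snd Z = bc_snd W"
  by (cases Z; cases W) simp

instantiation bicomplex :: "{comm_ring_1, real_algebra_1}"
begin

definition "0 = Bicomplex 0 0"
definition "1 = Bicomplex 1 0"
definition "Z + W = Bicomplex (bc_fst Z + bc_fst W) (bc_snd Z + bc_snd W)"
definition "- Z = Bicomplex (- bc_fst Z) (- bc_snd Z)"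
definition "Z - W = Bicomplex (bc_fst Z - bc_fst W) (bc_snd Z - bc_snd W)"
definition "Z * W = Bicomplex (bc_fst Z * bc_fst W - bc_snd Z * bc_snd W)
                              (bc_fst Z * bc_snd W + bc_snd Z * bc_fst W)"
definition "r *\<^sub>R Z = Bicomplex (r *\<^sub>R bc_fst Z) (r *\<^sub>R bc_snd Z)"

instance
  by intro_classes
    (simp_all add: bicomplex_eq_iff zero_bicomplex_def one_bicomplex_def plus_bicomplex_def
      uminus_bicomplex_def minus_bicomplex_def times_bicomplex_def scaleR_bicomplex_def
      algebra_simps)

end

definition bc_of_complex :: "complex \<Rightarrow> bicomplex" where
  "bc_of_complex z = Bicomplex z 0"

definition bc_i :: bicomplex where "bc_i = bc_of_complex \<i>"
definition bc_j :: bicomplex where "bc_j = Bicomplex 0 1"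
definition bc_k :: bicomplex where "bc_k = bc_i * bc_j"

definition bc_e1 :: bicomplex where "bc_e1 = (1 + bc_k) /\<^sub>R 2"
definition bc_e2 :: bicomplex where "bc_e2 = (1 - bc_k) /\<^sub>R 2"

text \<open>The components of \<open>Z = e\<^sub>1 z\<^sub>1 + e\<^sub>2 z\<^sub>2\<close>. The formulas come from \<open>e\<^sub>1 j = - e\<^sub>1 i\<close> and
  \<open>e\<^sub>2 j = e\<^sub>2 i\<close>; \<open>bc_idempotent_decomp\<close> below shows existence and uniqueness.\<close>

definition bc_idem1 :: "bicomplex \<Rightarrow> complex" where
  "bc_idem1 Z = bc_fst Z - \<i> * bc_snd Z"
definition bc_idem2 :: "bicomplex \<Rightarrow> complex" where
  "bc_idem2 Z = bc_fst Z + \<i> * bc_snd Z"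

lemmas bicomplex_defs = zero_bicomplex_def one_bicomplex_def plus_bicomplex_def
  uminus_bicomplex_def minus_bicomplex_def times_bicomplex_def scaleR_bicomplex_def
  bc_of_complex_def bc_i_def bc_j_def bc_k_def bc_e1_def bc_e2_def bc_idem1_def bc_idem2_def

lemma bicomplex_decomp: "Bicomplex z1 z2 = bc_of_complex z1 + bc_of_complex z2 * bc_j"
  by (simp add: bicomplex_defs)

lemma bicomplex_units:
  "bc_i * bc_i = -1" "bc_j * bc_j = -1" "bc_j * bc_i = bc_k" "bc_k * bc_k = 1"
  by (simp_all add: bicomplex_defs)

lemma bc_idempotents:
  "bc_e1 * bc_e1 = bc_e1" "bc_e2 * bc_e2 = bc_e2" "bc_e1 + bc_e2 = 1" "bc_e1 * bc_e2 = 0"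
  by (simp_all add: bicomplex_defs complex_eq_iff)

lemma bc_idempotent_decomp:
  "Z = bc_e1 * bc_of_complex z1 + bc_e2 * bc_of_complex z2
    \<longleftrightarrow> z1 = bc_idem1 Z \<and> z2 = bc_idem2 Z"
  by (cases Z) (auto simp: bicomplex_defs complex_eq_iff field_simps)

section \<open>Hyperbolic numbers\<close>

definition hyperbolics :: "bicomplex set" where
  "hyperbolics = {of_real b1 + bc_k * of_real b2 | b1 b2. True}"

definition hyperbolics_nonneg :: "bicomplex set" where
  "hyperbolics_nonneg = {bc_e1 * of_real a1 + bc_e2 * of_real a2 | a1 a2. 0 \<le> a1 \<and> 0 \<le> a2}"

definition hyp_le :: "bicomplex \<Rightarrow> bicomplex \<Rightarrow> bool"  (infix "\<le>\<^sub>D" 50) where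
  "a \<le>\<^sub>D b \<longleftrightarrow> a \<in> hyperbolics \<and> b \<in> hyperbolics \<and> b - a \<in> hyperbolics_nonneg"

definition hyp_abs :: "bicomplex \<Rightarrow> bicomplex" where
  "hyp_abs Z = bc_e1 * of_real (cmod (bc_idem1 Z)) + bc_e2 * of_real (cmod (bc_idem2 Z))"

text \<open>On \<open>hyperbolics\<close> both components are real.\<close>

definition hyp_tendsto :: "('i \<Rightarrow> bicomplex) \<Rightarrow> bicomplex \<Rightarrow> 'i filter \<Rightarrow> bool" where
  "hyp_tendsto f L F \<longleftrightarrow>
    ((\<lambda>i. bc_idem1 (f i)) \<longlongrightarrow> bc_idem1 L) F \<and> ((\<lambda>i. bc_idem2 (f i)) \<longlongrightarrow> bc_idem2 L) F"

lemma bc_of_real: "of_real r = bc_of_complex (of_real r)"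
  by (simp add: of_real_def bicomplex_defs)

lemma hyperbolics_iff:
  "Z \<in> hyperbolics \<longleftrightarrow> bc_idem1 Z \<in> \<real> \<and> bc_idem2 Z \<in> \<real>"
proof
  assume "Z \<in> hyperbolics"
  then show "bc_idem1 Z \<in> \<real> \<and> bc_idem2 Z \<in> \<real>"
    by (auto simp: hyperbolics_def bc_of_real bicomplex_defs complex_is_Real_iff)
next
  assume A: "bc_idem1 Z \<in> \<real> \<and> bc_idem2 Z \<in> \<real>"
  have "Z = of_real (Re (bc_fst Z)) + bc_k * of_real (Im (bc_snd Z))"
    using A by (cases Z)
      (auto simp: bc_of_real bicomplex_defs complex_is_Real_iff complex_eq_iff)
  then show "Z \<in> hyperbolics"
    unfolding hyperbolics_def by blast
qed

section \<open>Hyperbolic semi-norms and norms on bicomplex modules\<close>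

locale hyperbolic_seminorm = module scale
  for scale :: "bicomplex \<Rightarrow> 'a::ab_group_add \<Rightarrow> 'a" +
  fixes p :: "'a \<Rightarrow> bicomplex"
  assumes in_nonneg: "p x \<in> hyperbolics_nonneg"
    and scale_eq: "p (scale \<mu> x) = hyp_abs \<mu> * p x"
    and triangle: "p (x + y) \<le>\<^sub>D p x + p y"

locale hyperbolic_norm = hyperbolic_seminorm scale nrm
  for scale :: "bicomplex \<Rightarrow> 'a::ab_group_add \<Rightarrow> 'a" and nrm :: "'a \<Rightarrow> bicomplex" +
  assumes eq_zero: "nrm x = 0 \<Longrightarrow> x = 0"

definition hnorm_tendsto :: "('a::ab_group_add \<Rightarrow> bicomplex) \<Rightarrow> (nat \<Rightarrow> 'a) \<Rightarrow> 'a \<Rightarrow> bool" where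
  "hnorm_tendsto nrm x l \<longleftrightarrow> hyp_tendsto (\<lambda>n. nrm (x n - l)) 0 sequentially"

definition hnorm_Cauchy :: "('a::ab_group_add \<Rightarrow> bicomplex) \<Rightarrow> (nat \<Rightarrow> 'a) \<Rightarrow> bool" where
  "hnorm_Cauchy nrm x \<longleftrightarrow>
    hyp_tendsto (\<lambda>(m, n). nrm (x m - x n)) 0 (sequentially \<times>\<^sub>F sequentially)"

locale F_BC_module = hyperbolic_norm scale nrm
  for scale :: "bicomplex \<Rightarrow> 'a::ab_group_add \<Rightarrow> 'a" and nrm :: "'a \<Rightarrow> bicomplex" +
  assumes complete: "hnorm_Cauchy nrm x \<Longrightarrow> \<exists>l. hnorm_tendsto nrm x l"

definition hnorm_continuous ::
  "('a::ab_group_add \<Rightarrow> bicomplex) \<Rightarrow> ('a \<Rightarrow> bicomplex) \<Rightarrow> bool" where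
  "hnorm_continuous nrm p \<longleftrightarrow>
    (\<forall>x l. hnorm_tendsto nrm x l \<longrightarrow> hyp_tendsto (\<lambda>n. p (x n)) (p l) sequentially)"

end

(* Each idempotent component of a hyperbolic semi-norm is a real semi-norm, and multiplication
   by e_1 or e_2 kills the other component. If no constant bounds a component of p by the same
   component of the norm, there are x_n on which the quotient exceeds n; scaling e_i x_n so that
   the component of p equals 1 gives a null sequence along which p does not tend to 0. Conversely,
   the reverse triangle inequality in each component turns the bound into continuity. *)

theory Submission
  imports Defs
begin

text \<open>Since \<open>bc_e1\<close> and \<open>bc_e2\<close> are orthogonal idempotents, products
  are computed componentwise. With the rules that follow, identities between bicomplex numbers
  become pairs of complex ones.\<close>

lemma bc_idem_mult [simp]:
  "bc_idem1 (Z * W) = bc_idem1 Z * bc_idem1 W"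
  "bc_idem2 (Z * W) = bc_idem2 Z * bc_idem2 W"
  by (simp_all add: bicomplex_defs complex_eq_iff algebra_simps)

lemma bc_idem_add [simp]:
  "bc_idem1 (Z + W) = bc_idem1 Z + bc_idem1 W"
  "bc_idem2 (Z + W) = bc_idem2 Z + bc_idem2 W"
  by (simp_all add: bicomplex_defs algebra_simps)

lemma bc_idem_diff [simp]:
  "bc_idem1 (Z - W) = bc_idem1 Z - bc_idem1 W"
  "bc_idem2 (Z - W) = bc_idem2 Z - bc_idem2 W"
  by (simp_all add: bicomplex_defs algebra_simps)

lemma bc_idem_of_real [simp]:
  "bc_idem1 (of_real r) = of_real r"
  "bc_idem2 (of_real r) = of_real r"
  by (simp_all add: bc_of_real bicomplex_defs)

lemma bc_idem_0 [simp]: "bc_idem1 0 = 0" "bc_idem2 0 = 0"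
  by (simp_all add: bicomplex_defs)

lemma bc_idem_idempotents [simp]:
  "bc_idem1 bc_e1 = 1" "bc_idem2 bc_e1 = 0" "bc_idem1 bc_e2 = 0" "bc_idem2 bc_e2 = 1"
  by (simp_all add: bicomplex_defs complex_eq_iff)

lemma bc_eq_iff_idem: "Z = W \<longleftrightarrow> bc_idem1 Z = bc_idem1 W \<and> bc_idem2 Z = bc_idem2 W"
  by (metis bc_idempotent_decomp)

lemma bc_idem_hyp_abs [simp]:
  "bc_idem1 (hyp_abs Z) = of_real (cmod (bc_idem1 Z))"
  "bc_idem2 (hyp_abs Z) = of_real (cmod (bc_idem2 Z))"
  by (simp_all add: hyp_abs_def)

text \<open>A complex number equals its own modulus exactly when it is a nonnegative real. Stated as
  such equations, positivity lets real arithmetic on moduli replace arithmetic in \<D>.\<close>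

lemma hyperbolics_nonneg_iff:
  "Z \<in> hyperbolics_nonneg \<longleftrightarrow>
    of_real (cmod (bc_idem1 Z)) = bc_idem1 Z \<and> of_real (cmod (bc_idem2 Z)) = bc_idem2 Z"
proof
  assume "Z \<in> hyperbolics_nonneg"
  then show "of_real (cmod (bc_idem1 Z)) = bc_idem1 Z \<and> of_real (cmod (bc_idem2 Z)) = bc_idem2 Z"
    by (auto simp: hyperbolics_nonneg_def)
next
  assume "of_real (cmod (bc_idem1 Z)) = bc_idem1 Z \<and> of_real (cmod (bc_idem2 Z)) = bc_idem2 Z"
  then have "Z = bc_e1 * of_real (cmod (bc_idem1 Z)) + bc_e2 * of_real (cmod (bc_idem2 Z))"
    by (simp add: bc_eq_iff_idem)
  then show "Z \<in> hyperbolics_nonneg"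
    unfolding hyperbolics_nonneg_def by fastforce
qed

lemma hyperbolics_nonneg_add:
  assumes "Z \<in> hyperbolics_nonneg" and "W \<in> hyperbolics_nonneg"
  shows "Z + W \<in> hyperbolics_nonneg"
proof -
  have sum: "of_real (cmod (z + w)) = z + w" if "of_real (cmod z) = z" "of_real (cmod w) = w" for z w
  proof -
    have "cmod (of_real (cmod z) + of_real (cmod w)) = cmod z + cmod w"
      by (simp flip: of_real_add)
    then show ?thesis
      using that by simp
  qed
  then show ?thesis
    using assms by (simp add: hyperbolics_nonneg_iff)
qed

lemma hyperbolics_nonneg_mult:
  "Z \<in> hyperbolics_nonneg \<Longrightarrow> W \<in> hyperbolics_nonneg \<Longrightarrow> Z * W \<in> hyperbolics_nonneg"
  by (simp add: hyperbolics_nonneg_iff norm_mult)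

lemma complex_nonneg_diff_iff:
  assumes "of_real (cmod z) = z" and "of_real (cmod w) = w"
  shows "of_real (cmod (w - z)) = w - z \<longleftrightarrow> cmod z \<le> cmod w"
proof -
  have "w - z = of_real (cmod w - cmod z)"
    using assms by simp
  then show ?thesis
    by (metis norm_of_real of_real_eq_iff abs_of_nonneg abs_ge_zero diff_ge_0_iff_ge)
qed

text \<open>On the nonnegative cone both components are real and equal their moduli, so the
  positivity of \<open>W - Z\<close> amounts to two real inequalities.\<close>

lemma hyp_le_iff:
  assumes "Z \<in> hyperbolics_nonneg" and "W \<in> hyperbolics_nonneg"
  shows "Z \<le>\<^sub>D W \<longleftrightarrow>
    cmod (bc_idem1 Z) \<le> cmod (bc_idem1 W) \<and> cmod (bc_idem2 Z) \<le> cmod (bc_idem2 W)"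
proof -
  have "Z \<in> hyperbolics" "W \<in> hyperbolics"
    using assms unfolding hyperbolics_nonneg_iff hyperbolics_iff by (metis Reals_of_real)+
  then show ?thesis
    using assms by (simp add: hyp_le_def hyperbolics_nonneg_iff complex_nonneg_diff_iff)
qed

context hyperbolic_seminorm
begin

text \<open>A component of \<open>p\<close> sees only the matching component of the scalar. Hence
  multiples of \<open>bc_e1\<close> or \<open>bc_e2\<close> can isolate one component.\<close>

lemma cmod_idem_scale:
  "cmod (bc_idem1 (p (scale \<mu> x))) = cmod (bc_idem1 \<mu>) * cmod (bc_idem1 (p x))"
  "cmod (bc_idem2 (p (scale \<mu> x))) = cmod (bc_idem2 \<mu>) * cmod (bc_idem2 (p x))"
  by (simp_all add: scale_eq norm_mult)

lemma zero: "p 0 = 0"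
  using scale_eq[of 0 0] by (simp add: bc_eq_iff_idem)

lemma minus: "p (- x) = p x"
proof -
  have "hyp_abs (- 1) = 1"
    by (simp add: hyp_abs_def bicomplex_defs complex_eq_iff)
  then show ?thesis
    using scale_eq[of "- 1" x] by simp
qed

lemma cmod_idem_triangle:
  "cmod (bc_idem1 (p (x + y))) \<le> cmod (bc_idem1 (p x)) + cmod (bc_idem1 (p y))"
  "cmod (bc_idem2 (p (x + y))) \<le> cmod (bc_idem2 (p x)) + cmod (bc_idem2 (p y))"
proof -
  have "p (x + y) \<le>\<^sub>D p x + p y"
    by (rule triangle)
  then have "cmod (bc_idem1 (p (x + y))) \<le> cmod (bc_idem1 (p x + p y))"
    and "cmod (bc_idem2 (p (x + y))) \<le> cmod (bc_idem2 (p x + p y))"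
    by (simp_all add: hyp_le_iff in_nonneg hyperbolics_nonneg_add)
  then show "cmod (bc_idem1 (p (x + y))) \<le> cmod (bc_idem1 (p x)) + cmod (bc_idem1 (p y))"
    "cmod (bc_idem2 (p (x + y))) \<le> cmod (bc_idem2 (p x)) + cmod (bc_idem2 (p y))"
    by (metis bc_idem_add order_trans norm_triangle_ineq)+
qed

text \<open>Reverse triangle inequality, from \<open>x = (x - y) + y\<close> and
  \<open>y = (y - x) + x\<close>. The components are nonnegative reals, so their distance is the
  difference of their moduli.\<close>

lemma cmod_idem_diff_le:
  "cmod (bc_idem1 (p x) - bc_idem1 (p y)) \<le> cmod (bc_idem1 (p (x - y)))"
  "cmod (bc_idem2 (p x) - bc_idem2 (p y)) \<le> cmod (bc_idem2 (p (x - y)))"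
proof -
  have real_diff: "cmod (z - w) = \<bar>cmod z - cmod w\<bar>"
    if "of_real (cmod z) = z" "of_real (cmod w) = w" for z w
    using that by (metis norm_of_real of_real_diff)
  have sym: "p (y - x) = p (x - y)"
    using minus[of "x - y"] by simp
  show "cmod (bc_idem1 (p x) - bc_idem1 (p y)) \<le> cmod (bc_idem1 (p (x - y)))"
    using in_nonneg[of x] in_nonneg[of y]
      cmod_idem_triangle(1)[of "x - y" y] cmod_idem_triangle(1)[of "y - x" x]
    by (simp add: hyperbolics_nonneg_iff real_diff sym)
  show "cmod (bc_idem2 (p x) - bc_idem2 (p y)) \<le> cmod (bc_idem2 (p (x - y)))"
    using in_nonneg[of x] in_nonneg[of y]
      cmod_idem_triangle(2)[of "x - y" y] cmod_idem_triangle(2)[of "y - x" x]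
    by (simp add: hyperbolics_nonneg_iff real_diff sym)
qed

end

text \<open>In the application \<open>s r x = r e\<^sub>i x\<close>, the functions \<open>P\<close> and \<open>N\<close> are the \<open>i\<close>-th
  components of the semi-norm and the norm, and \<open>M\<close> is the other component of the norm.\<close>

lemma homogeneous_bounded_if_continuous_at_0:
  fixes s :: "real \<Rightarrow> 'a \<Rightarrow> 'a" and P N M :: "'a \<Rightarrow> real"
  assumes P: "\<And>r x. P (s r x) = \<bar>r\<bar> * P x"
    and N: "\<And>r x. N (s r x) = \<bar>r\<bar> * N x" "\<And>x. 0 \<le> N x"
    and M: "\<And>r x. M (s r x) = 0"
    and cont: "\<And>y. (\<lambda>n. N (y n)) \<longlonglongrightarrow> 0 \<Longrightarrow> (\<lambda>n. M (y n)) \<longlonglongrightarrow> 0 \<Longrightarrow> (\<lambda>n. P (y n)) \<longlonglongrightarrow> 0"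
  obtains a where "0 \<le> a" "\<And>x. P x \<le> a * N x"
proof (rule ccontr)
  assume not: "\<not> thesis"
  \<comment> \<open>Each \<open>Suc n\<close> is a nonnegative candidate for \<open>a\<close> and
    must therefore fail. Starting at 1 keeps the factor positive, so that it can be divided by
    below.\<close>
  have "\<exists>x. real (Suc n) * N x < P x" for n
    using that[of "real (Suc n)"] not by (meson not_le of_nat_0_le_iff)
  then obtain x where x: "\<And>n. real (Suc n) * N (x n) < P (x n)"
    by metis
  have pos: "0 < P (x n)" for n
    using x[of n] N(2)[of "x n"] by (meson le_less_trans mult_nonneg_nonneg of_nat_0_le_iff)
  define y where "y n = s (1 / P (x n)) (x n)" for n
  have P_y: "P (y n) = 1" for n
    using pos[of n] by (simp add: y_def P)
  have "N (y n) \<le> inverse (real (Suc n))" for n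
    using x[of n] pos[of n] by (simp add: y_def N(1) field_simps)
  then have "(\<lambda>n. N (y n)) \<longlonglongrightarrow> 0"
    by (intro tendsto_sandwich[OF _ _ tendsto_const LIMSEQ_inverse_real_of_nat]) (simp_all add: N(2))
  \<comment> \<open>Every \<open>y n\<close> is a value of \<open>s\<close>, so \<open>M\<close>
    vanishes along the sequence and continuity applies.\<close>
  then have "(\<lambda>n. P (y n)) \<longlonglongrightarrow> 0"
    by (intro cont) (simp_all add: y_def M)
  then show False
    by (simp add: P_y LIMSEQ_const_iff)
qed

lemma hyp_tendsto_0_iff:
  "hyp_tendsto f 0 F \<longleftrightarrow>
    ((\<lambda>i. cmod (bc_idem1 (f i))) \<longlongrightarrow> 0) F \<and> ((\<lambda>i. cmod (bc_idem2 (f i))) \<longlongrightarrow> 0) F"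
  by (simp add: hyp_tendsto_def tendsto_norm_zero_iff)

theorem lemma3p1:
  fixes scale :: "bicomplex \<Rightarrow> 'a::ab_group_add \<Rightarrow> 'a"
    and nrm p :: "'a \<Rightarrow> bicomplex"
  assumes "F_BC_module scale nrm"
    and "hyperbolic_seminorm scale p"
  shows "hnorm_continuous nrm p \<longleftrightarrow>
    (\<exists>\<alpha>\<in>hyperbolics_nonneg. \<forall>x. p x \<le>\<^sub>D \<alpha> * nrm x)"
proof -
  interpret N: F_BC_module scale nrm by fact
  interpret P: hyperbolic_seminorm scale p by fact
  have bound_iff: "p x \<le>\<^sub>D \<alpha> * nrm x \<longleftrightarrow>
      cmod (bc_idem1 (p x)) \<le> cmod (bc_idem1 \<alpha>) * cmod (bc_idem1 (nrm x)) \<and>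
      cmod (bc_idem2 (p x)) \<le> cmod (bc_idem2 \<alpha>) * cmod (bc_idem2 (nrm x))"
    if "\<alpha> \<in> hyperbolics_nonneg" for \<alpha> x
    using that by (simp add: hyp_le_iff P.in_nonneg N.in_nonneg hyperbolics_nonneg_mult norm_mult)
  show ?thesis
  proof
    assume cont: "hnorm_continuous nrm p"
    \<comment> \<open>Only continuity at the origin is extracted here, where
      \<open>p 0 = 0\<close>.\<close>
    have cont_0: "hyp_tendsto (\<lambda>n. p (y n)) 0 sequentially"
      if "(\<lambda>n. cmod (bc_idem1 (nrm (y n)))) \<longlonglongrightarrow> 0" "(\<lambda>n. cmod (bc_idem2 (nrm (y n)))) \<longlonglongrightarrow> 0"
      for y
    proof -
      have "hnorm_tendsto nrm y 0"
        using that by (simp add: hnorm_tendsto_def hyp_tendsto_0_iff)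
      then show ?thesis
        using cont unfolding hnorm_continuous_def by (metis P.zero)
    qed
    \<comment> \<open>The scalar \<open>of_real r * bc_e1\<close> has components \<open>r\<close>
      and 0: it scales the first component of both \<open>p\<close> and \<open>nrm\<close> by the
      modulus of \<open>r\<close> and annihilates the second component of
      \<open>nrm\<close>.\<close>
    obtain a where a: "0 \<le> a" "\<And>x. cmod (bc_idem1 (p x)) \<le> a * cmod (bc_idem1 (nrm x))"
      by (rule homogeneous_bounded_if_continuous_at_0[of "\<lambda>x. cmod (bc_idem1 (p x))"
            "\<lambda>r. scale (of_real r * bc_e1)" "\<lambda>x. cmod (bc_idem1 (nrm x))"
            "\<lambda>x. cmod (bc_idem2 (nrm x))"])
        (use cont_0 in \<open>auto simp: P.cmod_idem_scale N.cmod_idem_scale hyp_tendsto_0_iff\<close>)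
    obtain b where b: "0 \<le> b" "\<And>x. cmod (bc_idem2 (p x)) \<le> b * cmod (bc_idem2 (nrm x))"
      by (rule homogeneous_bounded_if_continuous_at_0[of "\<lambda>x. cmod (bc_idem2 (p x))"
            "\<lambda>r. scale (of_real r * bc_e2)" "\<lambda>x. cmod (bc_idem2 (nrm x))"
            "\<lambda>x. cmod (bc_idem1 (nrm x))"])
        (use cont_0 in \<open>auto simp: P.cmod_idem_scale N.cmod_idem_scale hyp_tendsto_0_iff\<close>)
    let ?\<alpha> = "bc_e1 * of_real a + bc_e2 * of_real b"
    have "?\<alpha> \<in> hyperbolics_nonneg"
      using a(1) b(1) by (auto simp: hyperbolics_nonneg_def)
    moreover from this have "p x \<le>\<^sub>D ?\<alpha> * nrm x" for x
      using a b by (simp add: bound_iff)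
    ultimately show "\<exists>\<alpha>\<in>hyperbolics_nonneg. \<forall>x. p x \<le>\<^sub>D \<alpha> * nrm x"
      by blast
  next
    assume "\<exists>\<alpha>\<in>hyperbolics_nonneg. \<forall>x. p x \<le>\<^sub>D \<alpha> * nrm x"
    then obtain \<alpha> where le:
      "\<And>x. cmod (bc_idem1 (p x)) \<le> cmod (bc_idem1 \<alpha>) * cmod (bc_idem1 (nrm x))"
      "\<And>x. cmod (bc_idem2 (p x)) \<le> cmod (bc_idem2 \<alpha>) * cmod (bc_idem2 (nrm x))"
      using bound_iff by blast
    show "hnorm_continuous nrm p"
      unfolding hnorm_continuous_def
    proof (intro allI impI)
      fix x l
      assume "hnorm_tendsto nrm x l"
      then have lim: "(\<lambda>n. cmod (bc_idem1 (nrm (x n - l)))) \<longlonglongrightarrow> 0"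
        "(\<lambda>n. cmod (bc_idem2 (nrm (x n - l)))) \<longlonglongrightarrow> 0"
        by (simp_all add: hnorm_tendsto_def hyp_tendsto_0_iff)
      \<comment> \<open>The reverse triangle inequality and the bound at \<open>x n - l\<close>
        dominate this difference by a constant multiple of a null sequence.\<close>
      have "(\<lambda>n. bc_idem1 (p (x n)) - bc_idem1 (p l)) \<longlonglongrightarrow> 0"
        using order_trans[OF P.cmod_idem_diff_le(1) le(1)]
        by (intro tendsto_0_le[OF lim(1), where K = "cmod (bc_idem1 \<alpha>)"] always_eventually)
          (simp add: mult.commute)
      moreover have "(\<lambda>n. bc_idem2 (p (x n)) - bc_idem2 (p l)) \<longlonglongrightarrow> 0"
        using order_trans[OF P.cmod_idem_diff_le(2) le(2)]
        by (intro tendsto_0_le[OF lim(2), where K = "cmod (bc_idem2 \<alpha>)"] always_eventually)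
          (simp add: mult.commute)
      ultimately show "hyp_tendsto (\<lambda>n. p (x n)) (p l) sequentially"
        by (simp add: hyp_tendsto_def LIM_zero_iff)
    qed
  qed
qed

end
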